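(* Let $f:\mathbb{Z}\to\mathbb{R}$ be a function in $\ell^{1}(\mathbb{Z})$. Then $$\operatorname{Var} Mf\leq 2\,\|f\|_{\ell^{1}(\mathbb{Z})},$$ and the constant $C=2$ is the best possible (i.e. it is the smallest constant $C$ such that $\operatorname{Var} Mf\le C\|f\|_{\ell^1(\mathbb{Z})}$ for all $f\in\ell^1(\mathbb{Z})$). Moreover, equality $\operatorname{Var} Mf=2\|f\|_{\ell^1(\mathbb{Z})}$ is attained if and only if $f$ is a delta function.
   Context: For $f:\mathbb{Z}\to\mathbb{R}$: $\|f\|_{\ell^1(\mathbb{Z})}=\sum_{n\in\mathbb{Z}}|f(n)|$, and the total variation is $\operatorname{Var} f=\sum_{n\in\mathbb{Z}}|f(n+1)-f(n)|$. The discrete centered Hardy-Littlewood maximal function is $$Mf(n)=\sup_{r\in\mathbb{Z},\, r\ge 0}\ \frac{1}{2r+1}\sum_{k=-r}^{r}|f(n+k)|,\qquad n\in\mathbb{Z}.$$ A function $f:\mathbb{Z}\to\mathbb{R}$ is a delta function if there exist $p\in\mathbb{Z}$ and $k\in\mathbb{R}$ such that $f(p)=k$ and $f(n)=0$ for all $n\in\mathbb{Z}\setminus\{p\}$ (the value $k=0$ is allowed). *)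

theory Defs
  imports "HOL-Analysis.Analysis"
begin

text \<open>The true norm of \<open>f\<close> only when \<open>\<lambda>n. \<bar>f n\<bar>\<close> is summable, i.e. \<open>f\<close> is in \<open>\<ell>\<^sup>1(\<int>)\<close>;
  otherwise \<open>infsum\<close> defaults to 0.\<close>

definition l1_norm :: "(int \<Rightarrow> real) \<Rightarrow> real" where
  "l1_norm f = (\<Sum>\<^sub>\<infinity>n\<in>UNIV. \<bar>f n\<bar>)"

text \<open>The variation takes values in \<open>[0, \<infinity>]\<close>, so that an infinite variation
  really is \<open>\<infinity>\<close> and an upper bound on it includes the claim that it is finite.\<close>

definition total_variation :: "(int \<Rightarrow> real) \<Rightarrow> ennreal" where
  "total_variation f = (\<Sum>\<^sub>\<infinity>n\<in>UNIV. ennreal \<bar>f (n + 1) - f n\<bar>)"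

text \<open>The supremum is taken in the reals: the averages are bounded above whenever \<open>f\<close> is bounded, in particular for \<open>f\<close> in
  \<open>\<ell>\<^sup>1(\<int>)\<close>.\<close>

definition centered_maximal :: "(int \<Rightarrow> real) \<Rightarrow> int \<Rightarrow> real" where
  "centered_maximal f n =
     (SUP r::nat. 1 / (2 * real r + 1) * (\<Sum>k = - int r..int r. \<bar>f (n + k)\<bar>))"

definition is_delta_function :: "(int \<Rightarrow> real) \<Rightarrow> bool" where
  "is_delta_function f \<longleftrightarrow> (\<exists>p k. f p = k \<and> (\<forall>n. n \<noteq> p \<longrightarrow> f n = 0))"

end

theory Submission
  imports Defs "HOL-Real_Asymp.Real_Asymp"
begin

(* For each edge (n, n + 1) pick the endpoint c with the larger value of Mf and a radius r attaining
   it. Comparing with the average of radius r + 1 at the other endpoint, whose window contains the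
   first one, bounds the jump of Mf by (1/(2r+1) - 1/(2r+3)) times the sum of |f k| over
   |k - c| <= r. Hence |f k| enters with a coefficient at most 1/(2d+1) - 1/(2d+3), where d is the
   distance from k to the edge, and summing over all edges these coefficients telescope to 2.
   Equality forces r = d for every edge and every k in the support; the edge (k, k + 1) then
   excludes a second support point to the left of k. *)

definition window_average :: "(int \<Rightarrow> real) \<Rightarrow> nat \<Rightarrow> int \<Rightarrow> real" where
  "window_average f r n = (\<Sum>k\<in>{n - int r..n + int r}. \<bar>f k\<bar>) / (2 * real r + 1)"

text \<open>The loss in the normalising factor of an average when its radius grows from
  \<open>d\<close> to \<open>d + 1\<close>. It is used both with a radius and with a distance as its
  argument.\<close>

definition decrement :: "nat \<Rightarrow> real" where
  "decrement d = 1 / (2 * real d + 1) - 1 / (2 * real d + 3)"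

text \<open>The edge between \<open>n\<close> and \<open>n + 1\<close> is indexed by its left
  endpoint. The value is the distance from \<open>k\<close> to the nearer endpoint, hence the least
  radius at which a window centered at an endpoint can contain \<open>k\<close>.\<close>

definition edge_dist :: "int \<Rightarrow> int \<Rightarrow> nat" where
  "edge_dist k n = nat (if k \<le> n then n - k else k - n - 1)"

section \<open>Differences of sums, and the variation as a real sum\<close>

lemma has_sum_diff:
  fixes f g :: "'a \<Rightarrow> real"
  assumes "(f has_sum a) A" and "(g has_sum b) A"
  shows "((\<lambda>x. f x - g x) has_sum (a - b)) A"
  using has_sum_add[OF assms(1) has_sum_uminusI[OF assms(2)]] by simp

text \<open>The map \<open>ennreal\<close> is continuous and commutes with finite sums of
  nonnegative reals, so it carries the limit of the real partial sums to the extended sum.\<close>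

lemma total_variation_eqI:
  assumes "((\<lambda>n. \<bar>h (n + 1) - h n\<bar>) has_sum S) UNIV"
  shows "total_variation h = ennreal S"
proof -
  have "((\<lambda>F. ennreal (\<Sum>n\<in>F. \<bar>h (n + 1) - h n\<bar>)) \<longlongrightarrow> ennreal S) (finite_subsets_at_top UNIV)"
    using assms unfolding has_sum_def by (rule tendsto_ennrealI)
  moreover have "sum (\<lambda>n. ennreal \<bar>h (n + 1) - h n\<bar>)
      = (\<lambda>F. ennreal (\<Sum>n\<in>F. \<bar>h (n + 1) - h n\<bar>))"
    by (rule ext) (simp add: sum_ennreal)
  ultimately have "((\<lambda>n. ennreal \<bar>h (n + 1) - h n\<bar>) has_sum ennreal S) UNIV"
    unfolding has_sum_def by simp
  then show ?thesis
    unfolding total_variation_def by (rule infsumI)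
qed

section \<open>The maximal function as an attained supremum of window averages\<close>

lemma centered_maximal_eq_SUP: "centered_maximal f n = (SUP r. window_average f r n)"
proof -
  have "1 / (2 * real r + 1) * (\<Sum>k = - int r..int r. \<bar>f (n + k)\<bar>) = window_average f r n" for r
  proof -
    have "(\<Sum>k = - int r..int r. \<bar>f (n + k)\<bar>) = (\<Sum>k\<in>{n - int r..n + int r}. \<bar>f k\<bar>)"
      by (rule sum.reindex_bij_witness[of _ "\<lambda>k. k - n" "\<lambda>k. n + k"]) auto
    then show ?thesis
      by (simp add: window_average_def)
  qed
  then show ?thesis
    by (simp add: centered_maximal_def)
qed

lemma window_average_nonneg: "0 \<le> window_average f r n"
  by (simp add: window_average_def sum_nonneg)

lemma window_average_le:
  assumes "(\<lambda>n. \<bar>f n\<bar>) summable_on UNIV"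
  shows "window_average f r n \<le> l1_norm f / (2 * real r + 1)"
  unfolding window_average_def l1_norm_def
  by (intro divide_right_mono finite_sum_le_infsum assms) auto

lemma l1_norm_nonneg: "0 \<le> l1_norm f"
  by (simp add: l1_norm_def infsum_nonneg)

lemma bdd_above_window_average:
  assumes "(\<lambda>n. \<bar>f n\<bar>) summable_on UNIV"
  shows "bdd_above (range (\<lambda>r. window_average f r n))"
proof (rule bdd_aboveI2)
  fix r
  have "l1_norm f / (2 * real r + 1) \<le> l1_norm f / 1"
    by (intro divide_left_mono l1_norm_nonneg) auto
  then show "window_average f r n \<le> l1_norm f"
    using window_average_le[OF assms, of r n] by simp
qed

lemma window_average_le_centered_maximal:
  assumes "(\<lambda>n. \<bar>f n\<bar>) summable_on UNIV"
  shows "window_average f r n \<le> centered_maximal f n"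
  unfolding centered_maximal_eq_SUP
  by (rule cSUP_upper[OF UNIV_I bdd_above_window_average[OF assms]])

lemma window_average_tendsto_0:
  assumes "(\<lambda>n. \<bar>f n\<bar>) summable_on UNIV"
  shows "(\<lambda>r. window_average f r n) \<longlonglongrightarrow> 0"
proof (rule tendsto_sandwich[OF _ _ tendsto_const])
  show "\<forall>\<^sub>F r in sequentially. 0 \<le> window_average f r n"
    by (simp add: window_average_nonneg)
  show "\<forall>\<^sub>F r in sequentially. window_average f r n \<le> l1_norm f / (2 * real r + 1)"
    by (simp add: window_average_le[OF assms])
  have "(\<lambda>r. 1 / (2 * real r + 1)) \<longlonglongrightarrow> 0"
    by real_asymp
  from tendsto_mult_left[OF this, of "l1_norm f"]
  show "(\<lambda>r. l1_norm f / (2 * real r + 1)) \<longlonglongrightarrow> 0"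
    by simp
qed

text \<open>A positive term exceeds all but finitely many others, so a maximum over an initial
  segment is global; without a positive term the sequence is zero.\<close>

lemma nonneg_null_sequence_attains_sup:
  fixes a :: "nat \<Rightarrow> real"
  assumes "a \<longlonglongrightarrow> 0" and "\<And>r. 0 \<le> a r"
  obtains r where "\<And>s. a s \<le> a r"
proof (cases "\<exists>s. 0 < a s")
  case False
  then have "a s \<le> a 0" for s
    using assms(2)[of 0] by (meson not_less order_trans)
  then show ?thesis
    by (rule that)
next
  case True
  then obtain s where "0 < a s" ..
  then have "\<forall>\<^sub>F r in sequentially. a r < a s"
    using assms(1) by (rule order_tendstoD(2)[rotated])
  then obtain N where N: "\<And>r. r \<ge> N \<Longrightarrow> a r < a s"
    by (auto simp: eventually_sequentially)
  \<comment> \<open>The comparison term \<open>a s\<close> thus lies in the initial segment, and the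
    maximum there also dominates every term beyond \<open>N\<close>.\<close>
  have "s \<le> N"
    using N[of s] by linarith
  have "Max (a ` {..N}) \<in> a ` {..N}"
    by (rule Max_in) auto
  then obtain r where r: "a r = Max (a ` {..N})"
    by (metis imageE)
  have le: "a t \<le> a r" if "t \<le> N" for t
    unfolding r using that by simp
  have "a t \<le> a r" for t
    using le[of t] le[OF \<open>s \<le> N\<close>] N[of t] by linarith
  then show ?thesis
    by (rule that)
qed

lemma centered_maximal_attained:
  assumes "(\<lambda>n. \<bar>f n\<bar>) summable_on UNIV"
  obtains r where "centered_maximal f n = window_average f r n"
proof -
  obtain r where r: "\<And>s. window_average f s n \<le> window_average f r n"
    using nonneg_null_sequence_attains_sup[OF window_average_tendsto_0[OF assms]]
      window_average_nonneg by metis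
  have "centered_maximal f n \<le> window_average f r n"
    unfolding centered_maximal_eq_SUP by (rule cSUP_least) (auto intro: r)
  with window_average_le_centered_maximal[OF assms] show ?thesis
    by (intro that antisym)
qed

section \<open>The weights and their sum over all edges\<close>

lemma decrement_strict_antimono:
  assumes "d < e"
  shows "decrement e < decrement d"
proof -
  have eq: "decrement d = 2 / ((2 * real d + 1) * (2 * real d + 3))" for d
    by (simp add: decrement_def field_simps)
  show ?thesis
    unfolding eq using assms
    by (intro divide_strict_left_mono mult_strict_mono) auto
qed

lemma decrement_nonneg: "0 \<le> decrement d"
  by (simp add: decrement_def frac_le)

lemma decrement_le_iff: "decrement d \<le> decrement e \<longleftrightarrow> e \<le> d"
  using decrement_strict_antimono by (metis linorder_neqE_nat not_less order_less_imp_le order_refl)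

text \<open>The series telescopes from 1 down to the limit 0; nonnegative terms turn sequential
  convergence into unconditional summation.\<close>

lemma has_sum_decrement: "(decrement has_sum 1) UNIV"
proof (rule sums_nonneg_imp_has_sum)
  have "(\<lambda>d. 1 / (2 * real d + 1)) \<longlonglongrightarrow> 0"
    by real_asymp
  from telescope_sums'[OF this] show "decrement sums 1"
    by (simp add: decrement_def[abs_def] add.commute)
qed (rule decrement_nonneg)

text \<open>Seen from \<open>k\<close>, every distance occurs exactly once among the edges to the
  right and once among those to the left. Each side contributes 1, which is the source of the
  constant 2.\<close>

lemma has_sum_decrement_edge_dist: "((\<lambda>n. decrement (edge_dist k n)) has_sum 2) UNIV"
proof -
  have "((\<lambda>n. decrement (edge_dist k n)) has_sum 1) {k..}"
    by (rule has_sum_reindex_bij_witness[where i = "\<lambda>d. k + int d" and j = "\<lambda>n. nat (n - k)"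
          and T = UNIV and h = decrement and s' = 1, THEN iffD2])
      (auto simp: edge_dist_def has_sum_decrement)
  moreover have "((\<lambda>n. decrement (edge_dist k n)) has_sum 1) {..<k}"
    by (rule has_sum_reindex_bij_witness[where i = "\<lambda>d. k - 1 - int d" and j = "\<lambda>n. nat (k - n - 1)"
          and T = UNIV and h = decrement and s' = 1, THEN iffD2])
      (auto simp: edge_dist_def has_sum_decrement)
  ultimately have "((\<lambda>n. decrement (edge_dist k n)) has_sum (1 + 1)) ({k..} \<union> {..<k})"
    by (rule has_sum_Un_disjoint) auto
  moreover have "{k..} \<union> {..<k} = UNIV"
    by auto
  ultimately show ?thesis
    by simp
qed

section \<open>The jump across a single edge\<close>

lemma centered_maximal_diff_le:
  assumes f: "(\<lambda>n. \<bar>f n\<bar>) summable_on UNIV" and "\<bar>c - c'\<bar> \<le> 1"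
    and r: "centered_maximal f c = window_average f r c"
  shows "centered_maximal f c - centered_maximal f c'
    \<le> (\<Sum>k\<in>{c - int r..c + int r}. \<bar>f k\<bar>) * decrement r"
proof -
  let ?S = "\<Sum>k\<in>{c - int r..c + int r}. \<bar>f k\<bar>"
  \<comment> \<open>Moving the center by at most one and enlarging the radius by one keeps the old
    window inside the new one, which has \<open>2 * r + 3\<close> points.\<close>
  have "?S \<le> (\<Sum>k\<in>{c' - int (Suc r)..c' + int (Suc r)}. \<bar>f k\<bar>)"
    using assms(2) by (intro sum_mono2) auto
  then have "?S / (2 * real r + 3) \<le> window_average f (Suc r) c'"
    unfolding window_average_def by (simp add: add.commute divide_right_mono)
  also have "\<dots> \<le> centered_maximal f c'"
    by (rule window_average_le_centered_maximal[OF f])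
  finally show ?thesis
    unfolding r by (simp add: window_average_def decrement_def right_diff_distrib)
qed

lemma centered_maximal_jump_le:
  assumes f: "(\<lambda>n. \<bar>f n\<bar>) summable_on UNIV"
  obtains c r where "c = n \<or> c = n + 1"
    and "\<bar>centered_maximal f (n + 1) - centered_maximal f n\<bar>
      \<le> (\<Sum>k\<in>{c - int r..c + int r}. \<bar>f k\<bar>) * decrement r"
proof (cases "centered_maximal f (n + 1) \<le> centered_maximal f n")
  case True
  obtain r where "centered_maximal f n = window_average f r n"
    by (rule centered_maximal_attained[OF f])
  from centered_maximal_diff_le[OF f _ this, of "n + 1"] True show ?thesis
    by (intro that[of n r]) auto
next
  case False
  obtain r where "centered_maximal f (n + 1) = window_average f r (n + 1)"
    by (rule centered_maximal_attained[OF f])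
  from centered_maximal_diff_le[OF f _ this, of n] False show ?thesis
    by (intro that[of "n + 1" r]) auto
qed

section \<open>Weighted jump bounds and their total\<close>

lemma summable_on_mult_decrement:
  assumes "(\<lambda>n. \<bar>f n\<bar>) summable_on UNIV"
  shows "(\<lambda>k. \<bar>f k\<bar> * decrement (edge_dist k n)) summable_on UNIV"
proof (rule summable_on_comparison_test)
  show "(\<lambda>k. \<bar>f k\<bar> * decrement 0) summable_on UNIV"
    by (rule summable_on_cmult_left[OF assms])
  show "\<bar>f k\<bar> * decrement (edge_dist k n) \<le> \<bar>f k\<bar> * decrement 0" for k
    by (intro mult_left_mono) (auto simp: decrement_le_iff)
qed (simp add: decrement_nonneg)

text \<open>Nonnegativity allows the double sum over points and edges to be taken in either order;
  summing over the edges first gives \<open>2 * \<bar>f k\<bar>\<close> for each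
  \<open>k\<close>.\<close>

lemma has_sum_jump_bound:
  assumes f: "(\<lambda>n. \<bar>f n\<bar>) summable_on UNIV"
  shows "((\<lambda>n. \<Sum>\<^sub>\<infinity>k. \<bar>f k\<bar> * decrement (edge_dist k n)) has_sum (2 * l1_norm f)) UNIV"
proof -
  let ?g = "\<lambda>(k, n). \<bar>f k\<bar> * decrement (edge_dist k n)"
  have inner: "((\<lambda>n. ?g (k, n)) has_sum (\<bar>f k\<bar> * 2)) UNIV" for k
    by (simp add: has_sum_cmult_right has_sum_decrement_edge_dist)
  have outer: "((\<lambda>k. \<bar>f k\<bar> * 2) has_sum (l1_norm f * 2)) UNIV"
    unfolding l1_norm_def by (intro has_sum_cmult_left has_sum_infsum f)
  have "?g summable_on (UNIV \<times> UNIV)"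
    by (rule summable_on_SigmaI[OF inner])
      (use outer in \<open>auto simp: decrement_nonneg has_sum_imp_summable\<close>)
  then have "(?g has_sum (l1_norm f * 2)) (UNIV \<times> UNIV)"
    by (rule has_sum_SigmaI[OF inner outer])
  then have "((\<lambda>(n, k). \<bar>f k\<bar> * decrement (edge_dist k n)) has_sum (l1_norm f * 2)) (UNIV \<times> UNIV)"
    by (subst (asm) has_sum_swap) simp
  then have "((\<lambda>n. \<Sum>\<^sub>\<infinity>k. \<bar>f k\<bar> * decrement (edge_dist k n)) has_sum (l1_norm f * 2)) UNIV"
    by (rule has_sum_Sigma') (simp add: has_sum_infsum summable_on_mult_decrement[OF f])
  then show ?thesis
    by (simp add: mult.commute)
qed

text \<open>A point of the window has distance at most \<open>r\<close> from the edge, so its weight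
  in \<open>B\<close> is at least \<open>decrement r\<close>; points outside only add to
  \<open>B\<close>. If nothing is lost, every support point lies in the window and carries exactly
  the weight \<open>decrement r\<close>.\<close>

lemma window_sum_le_jump_bound:
  fixes r :: nat
  assumes f: "(\<lambda>n. \<bar>f n\<bar>) summable_on UNIV" and c: "c = n \<or> c = n + 1"
  defines "S \<equiv> (\<Sum>k\<in>{c - int r..c + int r}. \<bar>f k\<bar>) * decrement r"
    and "B \<equiv> (\<Sum>\<^sub>\<infinity>k. \<bar>f k\<bar> * decrement (edge_dist k n))"
  shows "S \<le> B" and "B \<le> S \<Longrightarrow> f k \<noteq> 0 \<Longrightarrow> edge_dist k n = r"
proof -
  let ?W = "{c - int r..c + int r}"
  \<comment> \<open>The pointwise gap between the two sums: it is nonnegative and has total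
    \<open>B - S\<close>.\<close>
  define d where "d k = \<bar>f k\<bar> * decrement (edge_dist k n)
    - (if k \<in> ?W then \<bar>f k\<bar> * decrement r else 0)" for k
  have dist: "edge_dist k n \<le> r" if "k \<in> ?W" for k
    using that c by (auto simp: edge_dist_def)
  have d_nonneg: "0 \<le> d k" for k
    using dist[of k] by (auto simp: d_def decrement_le_iff decrement_nonneg intro!: mult_left_mono)
  have W: "((\<lambda>k. if k \<in> ?W then \<bar>f k\<bar> * decrement r else 0) has_sum S) UNIV"
    by (rule has_sum_finite_neutralI[of ?W]) (auto simp: S_def sum_distrib_right)
  have "((\<lambda>k. \<bar>f k\<bar> * decrement (edge_dist k n)) has_sum B) UNIV"
    unfolding B_def by (rule has_sum_infsum[OF summable_on_mult_decrement[OF f]])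
  then have d: "(d has_sum (B - S)) UNIV"
    unfolding d_def[abs_def] by (rule has_sum_diff) (rule W)
  then show "S \<le> B"
    using has_sum_nonneg[OF d] d_nonneg by simp
  assume "B \<le> S" "f k \<noteq> 0"
  have "d k = 0"
    by (rule nonneg_infsum_le_0D[of d UNIV])
      (use d \<open>B \<le> S\<close> d_nonneg in \<open>auto simp: infsumI has_sum_imp_summable\<close>)
  \<comment> \<open>Positivity of the weight rules out a support point outside the window, where the
    gap would be positive.\<close>
  moreover have "0 < decrement (edge_dist k n)"
    using decrement_nonneg decrement_strict_antimono[OF lessI] by (rule le_less_trans)
  ultimately have "decrement (edge_dist k n) = decrement r"
    using \<open>f k \<noteq> 0\<close> by (auto simp: d_def split: if_splits)
  then show "edge_dist k n = r"
    by (metis decrement_le_iff order_antisym order_refl)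
qed

lemma jump_le:
  assumes f: "(\<lambda>n. \<bar>f n\<bar>) summable_on UNIV"
  shows "\<bar>centered_maximal f (n + 1) - centered_maximal f n\<bar>
    \<le> (\<Sum>\<^sub>\<infinity>k. \<bar>f k\<bar> * decrement (edge_dist k n))"
proof -
  obtain c r where cr: "c = n \<or> c = n + 1"
    "\<bar>centered_maximal f (n + 1) - centered_maximal f n\<bar>
      \<le> (\<Sum>k\<in>{c - int r..c + int r}. \<bar>f k\<bar>) * decrement r"
    by (rule centered_maximal_jump_le[OF f])
  from cr(2) window_sum_le_jump_bound(1)[OF f cr(1)] show ?thesis
    by (rule order_trans)
qed

text \<open>The radius chosen for the edge does not depend on the support point, so all support
  points share it as their distance.\<close>

lemma jump_eq_imp_equidistant:
  assumes f: "(\<lambda>n. \<bar>f n\<bar>) summable_on UNIV"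
    and eq: "\<bar>centered_maximal f (n + 1) - centered_maximal f n\<bar>
      = (\<Sum>\<^sub>\<infinity>k. \<bar>f k\<bar> * decrement (edge_dist k n))"
    and "f k \<noteq> 0" "f l \<noteq> 0"
  shows "edge_dist k n = edge_dist l n"
proof -
  obtain c r where cr: "c = n \<or> c = n + 1"
    "\<bar>centered_maximal f (n + 1) - centered_maximal f n\<bar>
      \<le> (\<Sum>k\<in>{c - int r..c + int r}. \<bar>f k\<bar>) * decrement r"
    by (rule centered_maximal_jump_le[OF f])
  from window_sum_le_jump_bound(2)[OF f cr(1) cr(2)[unfolded eq]] assms(3,4) show ?thesis
    by simp
qed

lemma variation_bound:
  assumes f: "(\<lambda>n. \<bar>f n\<bar>) summable_on UNIV"
  obtains V where "((\<lambda>n. \<bar>centered_maximal f (n + 1) - centered_maximal f n\<bar>) has_sum V) UNIV"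
    and "0 \<le> V" and "V \<le> 2 * l1_norm f"
proof -
  let ?h = "\<lambda>n. \<bar>centered_maximal f (n + 1) - centered_maximal f n\<bar>"
  have "?h summable_on UNIV"
    by (rule summable_on_comparison_test[OF has_sum_imp_summable[OF has_sum_jump_bound[OF f]]])
      (auto intro: jump_le[OF f])
  then obtain V where V: "(?h has_sum V) UNIV"
    by (auto simp: summable_on_def)
  show ?thesis
    by (rule that[OF V has_sum_nonneg[OF V] has_sum_mono[OF V has_sum_jump_bound[OF f]]])
      (auto intro: jump_le[OF f])
qed

lemma delta_if_variation_eq:
  assumes f: "(\<lambda>n. \<bar>f n\<bar>) summable_on UNIV"
    and V: "((\<lambda>n. \<bar>centered_maximal f (n + 1) - centered_maximal f n\<bar>) has_sum (2 * l1_norm f)) UNIV"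
  shows "is_delta_function f"
proof -
  let ?B = "\<lambda>n. \<Sum>\<^sub>\<infinity>k. \<bar>f k\<bar> * decrement (edge_dist k n)"
  let ?d = "\<lambda>n. ?B n - \<bar>centered_maximal f (n + 1) - centered_maximal f n\<bar>"
  \<comment> \<open>Nonnegative gaps with total 0 vanish one by one, so the jump bound is an
    equality at every edge.\<close>
  have d: "(?d has_sum 0) UNIV"
    using has_sum_diff[OF has_sum_jump_bound[OF f] V] by simp
  have "?d n = 0" for n
    by (rule nonneg_infsum_le_0D[of ?d UNIV])
      (use d jump_le[OF f] in \<open>auto simp: infsumI has_sum_imp_summable\<close>)
  then have equidistant: "edge_dist k n = edge_dist l n" if "f k \<noteq> 0" "f l \<noteq> 0" for k l n
    using jump_eq_imp_equidistant[OF f _ that, of n] by simp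
  \<comment> \<open>At the edge \<open>l\<close> the point \<open>l\<close> has distance 0, hence so
    has \<open>k\<close>, and \<open>k\<close> is \<open>l\<close> or \<open>l + 1\<close>.
    Exchanging the two points then gives equality.\<close>
  have "l \<le> k" if "f k \<noteq> 0" "f l \<noteq> 0" for k l
    using equidistant[OF that, of l] by (auto simp: edge_dist_def split: if_splits)
  then have unique: "k = l" if "f k \<noteq> 0" "f l \<noteq> 0" for k l
    using that by (meson order_antisym)
  show ?thesis
  \<comment> \<open>If \<open>f\<close> vanishes identically, it is a delta function of value 0 at
    any point.\<close>
  proof (cases "\<exists>p. f p \<noteq> 0")
    case True
    then show ?thesis
      unfolding is_delta_function_def using unique by metis
  qed (auto simp: is_delta_function_def)
qed

section \<open>Explicit computation for delta functions\<close>

context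
  fixes f :: "int \<Rightarrow> real" and p :: int
  assumes support: "\<And>n. n \<noteq> p \<Longrightarrow> f n = 0"
begin

lemma delta_has_sum: "((\<lambda>n. \<bar>f n\<bar>) has_sum \<bar>f p\<bar>) UNIV"
  by (rule has_sum_finite_neutralI[of "{p}"]) (auto simp: support)

lemma delta_l1_norm: "l1_norm f = \<bar>f p\<bar>"
  unfolding l1_norm_def by (rule infsumI[OF delta_has_sum])

lemma delta_window_average:
  "window_average f r n = (if \<bar>n - p\<bar> \<le> int r then \<bar>f p\<bar> / (2 * real r + 1) else 0)"
proof -
  have "(\<Sum>k\<in>{n - int r..n + int r}. \<bar>f k\<bar>)
    = (\<Sum>k\<in>{n - int r..n + int r}. if k = p then \<bar>f p\<bar> else 0)"
    by (rule sum.cong) (auto simp: support)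
  then show ?thesis
    by (auto simp: window_average_def)
qed

text \<open>Among the windows around \<open>n\<close> that reach \<open>p\<close>, the smallest has
  the largest average; its radius is the distance from \<open>n\<close> to \<open>p\<close>.\<close>

lemma delta_centered_maximal: "centered_maximal f n = \<bar>f p\<bar> / (2 * real_of_int \<bar>n - p\<bar> + 1)"
proof -
  have "(SUP r. window_average f r n) = window_average f (nat \<bar>n - p\<bar>) n"
  proof (rule cSup_eq_maximum)
    fix x assume "x \<in> range (\<lambda>r. window_average f r n)"
    then show "x \<le> window_average f (nat \<bar>n - p\<bar>) n"
      by (auto simp: delta_window_average nat_le_iff intro!: divide_left_mono mult_pos_pos add_nonneg_pos)
  qed simp
  then show ?thesis
    by (simp add: centered_maximal_eq_SUP delta_window_average)
qed

text \<open>The maximal function does not increase away from \<open>p\<close>, and the two values at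
  an edge are consecutive terms of the telescoping sequence, so the jump bound is attained at every
  edge.\<close>

lemma delta_jump:
  "\<bar>centered_maximal f (n + 1) - centered_maximal f n\<bar> = \<bar>f p\<bar> * decrement (edge_dist p n)"
proof (cases "p \<le> n")
  case True
  then have "centered_maximal f n - centered_maximal f (n + 1) = \<bar>f p\<bar> * decrement (edge_dist p n)"
    by (simp add: delta_centered_maximal edge_dist_def decrement_def right_diff_distrib algebra_simps)
  then show ?thesis
    using decrement_nonneg[of "edge_dist p n"] by (simp add: abs_minus_commute)
next
  case False
  then have "centered_maximal f (n + 1) - centered_maximal f n = \<bar>f p\<bar> * decrement (edge_dist p n)"
    by (simp add: delta_centered_maximal edge_dist_def decrement_def right_diff_distrib algebra_simps)
  then show ?thesis
    using decrement_nonneg[of "edge_dist p n"] by simp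
qed

lemma delta_total_variation: "total_variation (centered_maximal f) = ennreal (2 * l1_norm f)"
proof (rule total_variation_eqI)
  show "((\<lambda>n. \<bar>centered_maximal f (n + 1) - centered_maximal f n\<bar>) has_sum (2 * l1_norm f)) UNIV"
    unfolding delta_jump delta_l1_norm
    using has_sum_cmult_right[OF has_sum_decrement_edge_dist, of "\<bar>f p\<bar>" p] by (simp add: mult.commute)
qed

end

theorem theorem1:
  fixes f :: "int \<Rightarrow> real"
  assumes "(\<lambda>n. \<bar>f n\<bar>) summable_on UNIV"
  shows "total_variation (centered_maximal f) \<le> ennreal (2 * l1_norm f)
    \<and> (\<forall>C::real. (\<forall>g::int \<Rightarrow> real. (\<lambda>n. \<bar>g n\<bar>) summable_on UNIV \<longrightarrow>
          total_variation (centered_maximal g) \<le> ennreal (C * l1_norm g)) \<longrightarrow> 2 \<le> C)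
    \<and> (total_variation (centered_maximal f) = ennreal (2 * l1_norm f)
        \<longleftrightarrow> is_delta_function f)"
proof (intro conjI allI impI)
  obtain V where V: "((\<lambda>n. \<bar>centered_maximal f (n + 1) - centered_maximal f n\<bar>) has_sum V) UNIV"
    "0 \<le> V" "V \<le> 2 * l1_norm f"
    by (rule variation_bound[OF assms])
  note tv = total_variation_eqI[of "centered_maximal f", OF V(1)]
  show "total_variation (centered_maximal f) \<le> ennreal (2 * l1_norm f)"
    unfolding tv by (rule ennreal_leI[OF V(3)])
  show "total_variation (centered_maximal f) = ennreal (2 * l1_norm f) \<longleftrightarrow> is_delta_function f"
  proof
    assume "total_variation (centered_maximal f) = ennreal (2 * l1_norm f)"
    \<comment> \<open>On nonnegative reals \<open>ennreal\<close> is injective, so the signs of both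
      sides matter here.\<close>
    then have "V = 2 * l1_norm f"
      using V(2) l1_norm_nonneg[of f] by (simp add: tv)
    with V(1) show "is_delta_function f"
      by (intro delta_if_variation_eq[OF assms]) simp
  next
    assume "is_delta_function f"
    then show "total_variation (centered_maximal f) = ennreal (2 * l1_norm f)"
      unfolding is_delta_function_def using delta_total_variation by blast
  qed
next
  fix C :: real
  assume C: "\<forall>g::int \<Rightarrow> real. (\<lambda>n. \<bar>g n\<bar>) summable_on UNIV \<longrightarrow>
    total_variation (centered_maximal g) \<le> ennreal (C * l1_norm g)"
  \<comment> \<open>The unit delta at 0 has norm 1 and its maximal function has variation 2, so it
    tests \<open>C\<close> directly.\<close>
  let ?g = "\<lambda>n::int. if n = 0 then 1 else 0 :: real"
  have support: "n \<noteq> 0 \<Longrightarrow> ?g n = 0" for n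
    by simp
  have "total_variation (centered_maximal ?g) \<le> ennreal (C * l1_norm ?g)"
    by (rule C[THEN spec, THEN mp, OF has_sum_imp_summable[OF delta_has_sum[OF support]]])
  moreover have "l1_norm ?g = 1"
    using delta_l1_norm[OF support] by simp
  moreover have "total_variation (centered_maximal ?g) = ennreal (2 * l1_norm ?g)"
    by (rule delta_total_variation[OF support])
  ultimately have "ennreal 2 \<le> ennreal C"
    by simp
  \<comment> \<open>A negative \<open>C\<close> would be truncated to 0 by \<open>ennreal\<close>;
    this is excluded because 2 is positive.\<close>
  then show "2 \<le> C"
    by (subst (asm) ennreal_le_iff2) auto
qed

end
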